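(* A metric space $X$ is of countable asymptotic dimension if and only if it is of straight finite decomposition complexity.
   Context: A family of subsets of $X$ is uniformly bounded if the diameters of its members have a common finite upper bound. A family is $R$-disjoint if $d(x,y)\ge R$ whenever $x$ and $y$ belong to different elements of the family. A set $U$ is "expressed as a union of at most $k$ families from $\mathcal{V}$ that are $R$-disjoint" if there are at most $k$ subfamilies of $\mathcal{V}$, each $R$-disjoint, such that the union of all members of these subfamilies equals $U$. $X$ is of straight finite decomposition complexity if for any increasing sequence of positive real numbers $R_1<R_2<\ldots$ there is a finite sequence $\mathcal{V}_i$, $i\le n$, of families of subsets of $X$ such that: 1. $\mathcal{V}_1=\{X\}$; 2. each element $U\in\mathcal{V}_i$, $i<n$, can be expressed as a union of at most $2$ families from $\mathcal{V}_{i+1}$ that are $R_i$-disjoint; 3. $\mathcal{V}_n$ is uniformly bounded. $X$ is of countable asymptotic dimension if there is a sequence of integers $n_i\ge 1$, $i\ge 1$, such that for any sequence of positive real numbers $R_i$, $i\ge 1$, there is a sequence $\mathcal{V}_i$, $i\ge 1$, of families of subsets of $X$ such that: 1. $\mathcal{V}_1=\{X\}$; 2. each element $U\in\mathcal{V}_i$ can be expressed as a union of at most $n_i$ families from $\mathcal{V}_{i+1}$ that are $R_i$-disjoint; 3. at least one of the families $\mathcal{V}_i$ is uniformly bounded. *)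

theory Defs
  imports "HOL-Analysis.Abstract_Metric_Spaces"
begin

context Metric_space
begin

text \<open>A common finite bound on the diameters is a common bound on the distances within each
  member; this also covers empty members, without assigning them a diameter.\<close>

definition uniformly_bounded :: "'a set set \<Rightarrow> bool" where
  "uniformly_bounded \<V> \<longleftrightarrow> (\<exists>B::real. \<forall>V\<in>\<V>. \<forall>x\<in>V. \<forall>y\<in>V. d x y \<le> B)"

definition R_disjoint :: "real \<Rightarrow> 'a set set \<Rightarrow> bool" where
  "R_disjoint R \<F> \<longleftrightarrow> (\<forall>A\<in>\<F>. \<forall>B\<in>\<F>. A \<noteq> B \<longrightarrow> (\<forall>x\<in>A. \<forall>y\<in>B. d x y \<ge> R))"

definition expressed_as_union :: "'a set \<Rightarrow> nat \<Rightarrow> 'a set set \<Rightarrow> real \<Rightarrow> bool" where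
  "expressed_as_union U k \<V> R \<longleftrightarrow>
     (\<exists>\<FF>. finite \<FF> \<and> card \<FF> \<le> k \<and> (\<forall>\<F>\<in>\<FF>. \<F> \<subseteq> \<V> \<and> R_disjoint R \<F>) \<and> U = \<Union>(\<Union>\<FF>))"

text \<open>All sequences below are indexed from 1; a finite sequence of length \<open>n\<close> is a function on
  \<open>nat\<close> of which only the values at \<open>1, \<dots>, n\<close> are constrained.\<close>

definition straight_finite_decomposition_complexity :: bool where
  "straight_finite_decomposition_complexity \<longleftrightarrow>
     (\<forall>R :: nat \<Rightarrow> real. (\<forall>i\<ge>1. 0 < R i) \<and> (\<forall>i\<ge>1. R i < R (Suc i)) \<longrightarrow>
       (\<exists>n\<ge>1. \<exists>\<V> :: nat \<Rightarrow> 'a set set.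
          (\<forall>i\<in>{1..n}. \<V> i \<subseteq> Pow M) \<and>
          \<V> 1 = {M} \<and>
          (\<forall>i\<in>{1..<n}. \<forall>U\<in>\<V> i. expressed_as_union U 2 (\<V> (Suc i)) (R i)) \<and>
          uniformly_bounded (\<V> n)))"

definition countable_asymptotic_dimension :: bool where
  "countable_asymptotic_dimension \<longleftrightarrow>
     (\<exists>n :: nat \<Rightarrow> nat. (\<forall>i\<ge>1. 1 \<le> n i) \<and>
       (\<forall>R :: nat \<Rightarrow> real. (\<forall>i\<ge>1. 0 < R i) \<longrightarrow>
         (\<exists>\<V> :: nat \<Rightarrow> 'a set set.
            (\<forall>i\<ge>1. \<V> i \<subseteq> Pow M) \<and>
            \<V> 1 = {M} \<and>
            (\<forall>i\<ge>1. \<forall>U\<in>\<V> i. expressed_as_union U (n i) (\<V> (Suc i)) (R i)) \<and>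
            (\<exists>i\<ge>1. uniformly_bounded (\<V> i)))))"

end

end

theory Submission
  imports Defs
begin

text \<open>A decomposition into \<open>k\<close> families that are \<open>S\<close>-disjoint can be replaced by \<open>k\<close> successive
  decompositions into two families: split off the first family and keep the union of the
  remaining ones as a single set, since a one-member family is \<open>R\<close>-disjoint for every \<open>R\<close>. As the
  numbers \<open>n i\<close> of countable asymptotic dimension are known before the scales are chosen, one can
  apply that property to the scales \<open>R (1 + n 1 + \<dots> + n i)\<close>, which dominate all the scales needed
  while the \<open>i\<close>-th decomposition is performed in \<open>n i\<close> binary steps. Conversely, \<open>n i = 2\<close> works,
  since scales may be enlarged to a strictly increasing sequence and a finite sequence of families
  may be continued by repeating its last member.\<close>

context Metric_space
begin

lemma R_disjoint_mono: "R_disjoint S \<F> \<Longrightarrow> R \<le> S \<Longrightarrow> R_disjoint R \<F>"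
  unfolding R_disjoint_def by (meson order_trans)

lemma expressed_as_union_mono:
  assumes "expressed_as_union U k \<V> S" "k \<le> l" "\<V> \<subseteq> \<W>" "R \<le> S"
  shows "expressed_as_union U l \<W> R"
proof -
  obtain \<FF> where "finite \<FF>" "card \<FF> \<le> k" "\<forall>\<F>\<in>\<FF>. \<F> \<subseteq> \<V> \<and> R_disjoint S \<F>" "U = \<Union>(\<Union>\<FF>)"
    using assms(1) unfolding expressed_as_union_def by blast
  then show ?thesis
    using assms(2-4) R_disjoint_mono unfolding expressed_as_union_def
    by (intro exI[of _ \<FF>]) fastforce
qed

lemma expressed_as_union_two:
  assumes "\<F> \<subseteq> \<V>" "R_disjoint R \<F>" "\<G> \<subseteq> \<V>" "R_disjoint R \<G>"
  shows "expressed_as_union (\<Union>\<F> \<union> \<Union>\<G>) 2 \<V> R"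
  unfolding expressed_as_union_def
  \<comment> \<open>The two families may coincide; the set then has one element, which still
    respects the bound.\<close>
  by (rule exI[of _ "{\<F>, \<G>}"]) (use assms in \<open>auto simp: card_insert_if\<close>)

text \<open>Lets a set pass unchanged to the next family, whatever the scale.\<close>

lemma expressed_as_union_member:
  assumes "U \<in> \<V>" "1 \<le> k"
  shows "expressed_as_union U k \<V> R"
  unfolding expressed_as_union_def
  by (rule exI[of _ "{{U}}"]) (use assms in \<open>auto simp: R_disjoint_def\<close>)

lemma expressed_as_union_split:
  assumes "expressed_as_union U (Suc k) \<V> R"
  obtains \<F> U' where "\<F> \<subseteq> \<V>" "R_disjoint R \<F>" "U = \<Union>\<F> \<union> U'" "expressed_as_union U' k \<V> R"
proof -
  obtain \<FF> where \<FF>: "finite \<FF>" "card \<FF> \<le> Suc k"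
    "\<And>\<F>. \<F> \<in> \<FF> \<Longrightarrow> \<F> \<subseteq> \<V> \<and> R_disjoint R \<F>" "U = \<Union>(\<Union>\<FF>)"
    using assms unfolding expressed_as_union_def by blast
  show ?thesis
  \<comment> \<open>With no family to remove, \<open>U\<close> is empty and serves as its own
    remainder beside an empty \<open>\<F>\<close>.\<close>
  proof (cases "\<FF> = {}")
    case True
    then have "expressed_as_union U k \<V> R"
      using \<FF> unfolding expressed_as_union_def by (intro exI[of _ "{}"]) auto
    then show thesis
      by (intro that[of "{}" U]) (simp_all add: R_disjoint_def)
  next
    case False
    then obtain \<F> where \<F>: "\<F> \<in> \<FF>" by blast
    have "expressed_as_union (\<Union>(\<Union>(\<FF> - {\<F>}))) k \<V> R"
      unfolding expressed_as_union_def
      by (rule exI[of _ "\<FF> - {\<F>}"]) (use \<FF> \<F> in auto)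
    moreover have "U = \<Union>\<F> \<union> \<Union>(\<Union>(\<FF> - {\<F>}))"
      using \<FF>(4) \<F> by blast
    ultimately show ?thesis
      using that \<FF>(3)[OF \<F>] by blast
  qed
qed

lemma expressed_as_union_subset:
  assumes "expressed_as_union U k \<V> R" "\<V> \<subseteq> Pow M"
  shows "U \<subseteq> M"
  using assms unfolding expressed_as_union_def by blast

text \<open>Hiding the intermediate families makes chains easy to concatenate. Scales are tied to
  absolute positions, so a chain starting at \<open>m\<close> uses \<open>R m\<close> first.\<close>

inductive decomposition_chain :: "(nat \<Rightarrow> real) \<Rightarrow> nat \<Rightarrow> 'a set set \<Rightarrow> nat \<Rightarrow> 'a set set \<Rightarrow> bool"
  for R where
  refl: "decomposition_chain R m \<A> m \<A>"
| step: "decomposition_chain R m \<A> i \<B> \<Longrightarrow> \<C> \<subseteq> Pow M \<Longrightarrow>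
    \<forall>U\<in>\<B>. expressed_as_union U 2 \<C> (R i) \<Longrightarrow> decomposition_chain R m \<A> (Suc i) \<C>"

text \<open>The later chain is the first premise because \<open>step\<close> extends a chain at its
  far end, so the induction runs over that one.\<close>

lemma decomposition_chain_trans:
  assumes "decomposition_chain R l \<B> j \<C>" "decomposition_chain R i \<A> l \<B>"
  shows "decomposition_chain R i \<A> j \<C>"
  using assms by induction (auto intro: decomposition_chain.intros)

lemma decomposition_chain_sequence:
  assumes "decomposition_chain R m \<A> i \<B>" "\<A> \<subseteq> Pow M"
  shows "m \<le> i \<and> (\<exists>\<W>. \<W> m = \<A> \<and> \<W> i = \<B> \<and> (\<forall>j\<in>{m..i}. \<W> j \<subseteq> Pow M) \<and>
    (\<forall>j\<in>{m..<i}. \<forall>U\<in>\<W> j. expressed_as_union U 2 (\<W> (Suc j)) (R j)))"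
  using assms
proof induction
  case (refl m \<A>)
  then show ?case by (auto intro!: exI[of _ "\<lambda>_. \<A>"])
next
  case (step m \<A> i \<B> \<C>)
  from step.IH[OF step.prems] obtain \<W> where "m \<le> i" and \<W>: "\<W> m = \<A>" "\<W> i = \<B>" "\<forall>j\<in>{m..i}. \<W> j \<subseteq> Pow M"
    "\<forall>j\<in>{m..<i}. \<forall>U\<in>\<W> j. expressed_as_union U 2 (\<W> (Suc j)) (R j)"
    by (elim conjE exE)
  show ?case
  proof (intro conjI exI[of _ "\<W>(Suc i := \<C>)"])
    show "\<forall>j\<in>{m..Suc i}. (\<W>(Suc i := \<C>)) j \<subseteq> Pow M"
      using \<W>(3) step.hyps(2) by (simp add: Ball_def le_Suc_eq)
    show "\<forall>j\<in>{m..<Suc i}. \<forall>U\<in>(\<W>(Suc i := \<C>)) j.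
        expressed_as_union U 2 ((\<W>(Suc i := \<C>)) (Suc j)) (R j)"
      using \<W>(2,4) step.hyps by (auto simp: less_Suc_eq)
  qed (use \<W> \<open>m \<le> i\<close> in auto)
qed

text \<open>Each step peels off one family, so \<open>Suc k\<close> steps suffice; they use the
  scales \<open>R m\<close> to \<open>R (m + k)\<close>, all bounded by \<open>S\<close>.\<close>

lemma decomposition_chain_of_union:
  assumes "\<And>U. U \<in> \<A> \<Longrightarrow> expressed_as_union U (Suc k) \<B> S" "\<B> \<subseteq> Pow M"
    and "\<And>i. m \<le> i \<Longrightarrow> i \<le> m + k \<Longrightarrow> R i \<le> S"
  shows "decomposition_chain R m \<A> (m + Suc k) \<B>"
  using assms
proof (induction k arbitrary: m \<A>)
  case 0
  have "\<forall>U\<in>\<A>. expressed_as_union U 2 \<B> (R m)"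
    using 0 by (fastforce intro: expressed_as_union_mono[of _ "Suc 0" \<B> S])
  then show ?case
    using decomposition_chain.step[OF decomposition_chain.refl] 0 by simp
next
  case (Suc k)
  have "\<forall>U\<in>\<A>. \<exists>\<F> U'. \<F> \<subseteq> \<B> \<and> R_disjoint S \<F> \<and> U = \<Union>\<F> \<union> U' \<and> expressed_as_union U' (Suc k) \<B> S"
    using Suc.prems(1) by (metis expressed_as_union_split)
  then obtain \<F> \<rho> where split: "\<And>U. U \<in> \<A> \<Longrightarrow> \<F> U \<subseteq> \<B>" "\<And>U. U \<in> \<A> \<Longrightarrow> R_disjoint S (\<F> U)"
    "\<And>U. U \<in> \<A> \<Longrightarrow> U = \<Union>(\<F> U) \<union> \<rho> U" "\<And>U. U \<in> \<A> \<Longrightarrow> expressed_as_union (\<rho> U) (Suc k) \<B> S"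
    by metis
  \<comment> \<open>The intermediate family holds the finished pieces from \<open>\<B>\<close>
    together with the remainders still to be split.\<close>
  have "expressed_as_union U 2 (\<B> \<union> \<rho> ` \<A>) (R m)" if "U \<in> \<A>" for U
  proof -
    have "expressed_as_union (\<Union>(\<F> U) \<union> \<Union>{\<rho> U}) 2 (\<B> \<union> \<rho> ` \<A>) S"
      using split(1,2)[OF that] that by (intro expressed_as_union_two) (auto simp: R_disjoint_def)
    moreover have "\<Union>(\<F> U) \<union> \<Union>{\<rho> U} = U"
      using split(3)[OF that] by simp
    moreover have "R m \<le> S"
      using Suc.prems(3) by simp
    ultimately show ?thesis
      using expressed_as_union_mono[of U 2 _ S 2] by simp
  qed
  moreover have "\<B> \<union> \<rho> ` \<A> \<subseteq> Pow M"
    using Suc.prems(2) split(4) expressed_as_union_subset by blast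
  ultimately have first: "decomposition_chain R m \<A> (Suc m) (\<B> \<union> \<rho> ` \<A>)"
    by (intro decomposition_chain.step[OF decomposition_chain.refl]) auto
  \<comment> \<open>Finished pieces are represented by themselves while the remainders are split
    further, so the induction hypothesis covers both.\<close>
  have "expressed_as_union U (Suc k) \<B> S" if "U \<in> \<B> \<union> \<rho> ` \<A>" for U
    using that split(4) expressed_as_union_member by auto
  then have "decomposition_chain R (Suc m) (\<B> \<union> \<rho> ` \<A>) (Suc m + Suc k) \<B>"
    by (rule Suc.IH) (use Suc.prems in auto)
  then show ?case
    using decomposition_chain_trans[OF _ first] by simp
qed

lemma straight_finite_decomposition_complexity_if_countable_asymptotic_dimension:
  assumes countable_asymptotic_dimension
  shows straight_finite_decomposition_complexity
  unfolding straight_finite_decomposition_complexity_def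
proof (intro allI impI, elim conjE)
  fix R :: "nat \<Rightarrow> real"
  assume pos: "\<forall>i\<ge>1. 0 < R i" and incr: "\<forall>i\<ge>1. R i < R (Suc i)"
  \<comment> \<open>Monotonicity starts at index 1; \<open>R 0\<close> is arbitrary.\<close>
  have mono: "R i \<le> R j" if "1 \<le> i" "i \<le> j" for i j
    using that(2)
  proof (induction rule: dec_induct)
    case (step j)
    then show ?case
      using incr that(1) by (meson less_imp_le order_trans)
  qed simp
  obtain n :: "nat \<Rightarrow> nat" where n: "\<forall>i\<ge>1. 1 \<le> n i"
    and cad: "\<And>R :: nat \<Rightarrow> real. \<forall>i\<ge>1. 0 < R i \<Longrightarrow> \<exists>\<V>. (\<forall>i\<ge>1. \<V> i \<subseteq> Pow M) \<and> \<V> 1 = {M} \<and>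
        (\<forall>i\<ge>1. \<forall>U\<in>\<V> i. expressed_as_union U (n i) (\<V> (Suc i)) (R i)) \<and>
        (\<exists>i\<ge>1. uniformly_bounded (\<V> i))"
    using assms unfolding countable_asymptotic_dimension_def by (elim exE conjE) (rule that, auto)
  \<comment> \<open>\<open>N i\<close> is the position of \<open>\<V> i\<close> in the binary
    sequence; in particular \<open>N 1 = 1\<close>.\<close>
  define N where "N i = 1 + sum n {1..<i}" for i
  have N_Suc: "N (Suc i) = N i + n i" if "1 \<le> i" for i
    using that by (simp add: N_def)
  have N_ge: "1 \<le> N i" for i
    by (simp add: N_def)
  \<comment> \<open>The binary steps from \<open>\<V> i\<close> to \<open>\<V> (Suc i)\<close>
    occupy the positions from \<open>N i\<close> up to \<open>N (Suc i) - 1\<close>, so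
    \<open>R (N (Suc i))\<close> dominates their scales.\<close>
  have "\<forall>i\<ge>1. 0 < R (N (Suc i))"
    using pos N_ge by blast
  from cad[OF this] obtain \<V> p where \<V>: "\<And>i. 1 \<le> i \<Longrightarrow> \<V> i \<subseteq> Pow M" "\<V> 1 = {M}"
    "\<And>i U. 1 \<le> i \<Longrightarrow> U \<in> \<V> i \<Longrightarrow> expressed_as_union U (n i) (\<V> (Suc i)) (R (N (Suc i)))"
    and p: "1 \<le> p" "uniformly_bounded (\<V> p)"
    by (elim exE conjE) (rule that, auto)
  have "decomposition_chain R 1 {M} (N i) (\<V> i)" if "1 \<le> i" for i
    using that
  proof (induction rule: dec_induct)
    case base
    show ?case
      using \<V>(2) decomposition_chain.refl by (simp add: N_def)
  next
    case (step i)
    obtain k where k: "n i = Suc k"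
      using n step.hyps by (metis Suc_le_D One_nat_def)
    have "decomposition_chain R (N i) (\<V> i) (N i + Suc k) (\<V> (Suc i))"
    proof (rule decomposition_chain_of_union)
      show "expressed_as_union U (Suc k) (\<V> (Suc i)) (R (N (Suc i)))" if "U \<in> \<V> i" for U
        using \<V>(3) step.hyps that k by metis
      show "R j \<le> R (N (Suc i))" if "N i \<le> j" "j \<le> N i + k" for j
        using mono N_ge[of i] N_Suc step.hyps k that by simp
    qed (use \<V>(1) in simp)
    then show ?case
      using decomposition_chain_trans step N_Suc k by simp
  qed
  \<comment> \<open>The finite sequence has length \<open>N p\<close> and ends in the uniformly
    bounded \<open>\<V> p\<close>.\<close>
  from decomposition_chain_sequence[OF this[OF p(1)]] p(2)
  show "\<exists>n\<ge>1. \<exists>\<V>. (\<forall>i\<in>{1..n}. \<V> i \<subseteq> Pow M) \<and> \<V> 1 = {M} \<and>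
      (\<forall>i\<in>{1..<n}. \<forall>U\<in>\<V> i. expressed_as_union U 2 (\<V> (Suc i)) (R i)) \<and>
      uniformly_bounded (\<V> n)"
    by (metis Pow_top empty_subsetI insert_subset)
qed

lemma countable_asymptotic_dimension_if_straight_finite_decomposition_complexity:
  assumes straight_finite_decomposition_complexity
  shows countable_asymptotic_dimension
  unfolding countable_asymptotic_dimension_def
proof (intro exI[of _ "\<lambda>_. 2"] conjI allI impI)
  fix R :: "nat \<Rightarrow> real"
  assume pos: "\<forall>i\<ge>1. 0 < R i"
  \<comment> \<open>Partial sums of positive numbers increase strictly and dominate each
    summand.\<close>
  define S where "S i = sum R {1..i}" for i
  have S_incr: "\<forall>i\<ge>1. S i < S (Suc i)"
    using pos by (simp add: S_def)
  have R_le_S: "R i \<le> S i" if "1 \<le> i" for i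
    unfolding S_def using that pos by (intro member_le_sum) (auto intro: less_imp_le)
  then have "\<forall>i\<ge>1. 0 < S i"
    using pos by (meson less_le_trans)
  with assms S_incr have "\<exists>n\<ge>1. \<exists>\<V>. (\<forall>i\<in>{1..n}. \<V> i \<subseteq> Pow M) \<and> \<V> 1 = {M} \<and>
      (\<forall>i\<in>{1..<n}. \<forall>U\<in>\<V> i. expressed_as_union U 2 (\<V> (Suc i)) (S i)) \<and>
      uniformly_bounded (\<V> n)"
    unfolding straight_finite_decomposition_complexity_def by simp
  then obtain n \<V> where "1 \<le> n" and \<V>: "\<forall>i\<in>{1..n}. \<V> i \<subseteq> Pow M" "\<V> 1 = {M}"
    "\<forall>i\<in>{1..<n}. \<forall>U\<in>\<V> i. expressed_as_union U 2 (\<V> (Suc i)) (S i)" "uniformly_bounded (\<V> n)"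
    by (elim exE conjE) (rule that)
  show "\<exists>\<V>. (\<forall>i\<ge>1. \<V> i \<subseteq> Pow M) \<and> \<V> 1 = {M} \<and>
      (\<forall>i\<ge>1. \<forall>U\<in>\<V> i. expressed_as_union U 2 (\<V> (Suc i)) (R i)) \<and>
      (\<exists>i\<ge>1. uniformly_bounded (\<V> i))"
  \<comment> \<open>The index \<open>min i n\<close> freezes the sequence at \<open>\<V> n\<close>,
    whose members then represent themselves at every later scale.\<close>
  proof (rule exI[of _ "\<lambda>i. \<V> (min i n)"], intro conjI allI impI ballI)
    fix i U
    assume i: "1 \<le> i" and U: "U \<in> \<V> (min i n)"
    show "expressed_as_union U 2 (\<V> (min (Suc i) n)) (R i)"
    proof (cases "i < n")
      case True
      then have "expressed_as_union U 2 (\<V> (Suc i)) (S i)"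
        using \<V>(3) i U by simp
      then show ?thesis
        using True expressed_as_union_mono[OF _ order_refl order_refl R_le_S[OF i]] by (simp add: min_def)
    next
      case False
      then show ?thesis
        using U by (intro expressed_as_union_member) (simp_all add: min.absorb2)
    qed
  qed (use \<V> \<open>1 \<le> n\<close> in \<open>auto intro!: exI[of _ n]\<close>)
qed simp

end

theorem theorem8p4:
  fixes X :: "'a set" and d :: "'a \<Rightarrow> 'a \<Rightarrow> real"
  assumes "Metric_space X d"
  shows "Metric_space.countable_asymptotic_dimension X d
    \<longleftrightarrow> Metric_space.straight_finite_decomposition_complexity X d"
proof -
  interpret Metric_space X d by (fact assms)
  show ?thesis
    using straight_finite_decomposition_complexity_if_countable_asymptotic_dimension
      countable_asymptotic_dimension_if_straight_finite_decomposition_complexity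
    by blast
qed

end
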